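(* The relation of degree $1$ homeomorphism of compact subsets of $\mathbb{C}$, regarded as an equivalence relation on the standard Borel space $\mathcal{K}(\mathbb{C})$ of compact subsets of $\mathbb{C}$, is smooth.
   Context: $\mathcal{K}(\mathbb{C})$ carries the Effros Borel structure. A degree $1$ map on a closed set $D\subset\mathbb{C}$ is a function $f:D\to\mathbb{C}$ for which there are $\alpha,\beta,\gamma,\delta\in\mathbb{C}$ with $$f(z)=\alpha+\beta z+\gamma\bar z+\delta z\bar z\quad\text{for all }z\in D,$$ and moreover there are $\alpha',\beta',\gamma',\delta'\in\mathbb{C}$ with $$f(z)\overline{f(z)}=\alpha'+\beta' z+\gamma'\bar z+\delta' z\bar z\quad\text{for all }z\in D.$$ A degree $1$ homeomorphism from $D$ to $\widetilde D$ is a homeomorphism $\varphi:D\to\widetilde D$ such that $\varphi$ and $\varphi^{-1}$ are degree $1$ maps; $D$ and $\widetilde D$ are degree $1$ homeomorphic if such a $\varphi$ exists. An equivalence relation $E$ on a standard Borel space $X$ is smooth if there are a Polish space $Y$ and a Borel map $f:X\to Y$ with $x\,E\,x'\iff f(x)=f(x')$. *)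

theory Defs
  imports "HOL-Analysis.Analysis"
begin

definition deg1_form :: "complex set \<Rightarrow> (complex \<Rightarrow> complex) \<Rightarrow> bool" where
  "deg1_form D g \<longleftrightarrow>
     (\<exists>\<alpha> \<beta> \<gamma> \<delta>. \<forall>z\<in>D. g z = \<alpha> + \<beta> * z + \<gamma> * cnj z + \<delta> * z * cnj z)"

definition degree1_map :: "complex set \<Rightarrow> (complex \<Rightarrow> complex) \<Rightarrow> bool" where
  "degree1_map D f \<longleftrightarrow> deg1_form D f \<and> deg1_form D (\<lambda>z. f z * cnj (f z))"

definition degree1_homeomorphism ::
    "complex set \<Rightarrow> complex set \<Rightarrow> (complex \<Rightarrow> complex) \<Rightarrow> (complex \<Rightarrow> complex) \<Rightarrow> bool" where
  "degree1_homeomorphism D D' \<phi> \<psi> \<longleftrightarrow>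
     homeomorphism D D' \<phi> \<psi> \<and> degree1_map D \<phi> \<and> degree1_map D' \<psi>"

definition degree1_homeomorphic :: "complex set \<Rightarrow> complex set \<Rightarrow> bool" where
  "degree1_homeomorphic D D' \<longleftrightarrow> (\<exists>\<phi> \<psi>. degree1_homeomorphism D D' \<phi> \<psi>)"

text \<open>The Effros Borel space of closed sets, and its restriction to the compact sets.
  The empty set is a point of both spaces.\<close>

definition effros_borel :: "'a::topological_space set measure" where
  "effros_borel = sigma {F. closed F} {{F. closed F \<and> F \<inter> U \<noteq> {}} | U. open U}"

definition compacts_borel :: "'a::topological_space set measure" where
  "compacts_borel = restrict_space effros_borel {K. compact K}"

definition degree1_rel :: "(complex set \<times> complex set) set" where
  "degree1_rel = {(K, L). compact K \<and> compact L \<and> degree1_homeomorphic K L}"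

definition polish_topology :: "'a topology \<Rightarrow> bool" where
  "polish_topology Y \<longleftrightarrow> completely_metrizable_space Y \<and> separable_space Y"

definition borel_of_topology :: "'a topology \<Rightarrow> 'a measure" where
  "borel_of_topology Y = sigma (topspace Y) {U. openin Y U}"

text \<open>HOL cannot quantify existentially over the type of points of the Polish space, so its
  points are taken to be real sequences. This is no restriction: \<open>Y\<close> is an arbitrary topology on
  an arbitrary set of such sequences, and every Polish space has at most continuum many points,
  hence is homeomorphic to such a \<open>Y\<close>. The notion is intended for standard Borel spaces \<open>M\<close>;
  only the underlying measurable space of \<open>M\<close> is used, its measure being irrelevant.\<close>

definition smooth_equivalence :: "'a measure \<Rightarrow> ('a \<times> 'a) set \<Rightarrow> bool" where
  "smooth_equivalence M E \<longleftrightarrow> equiv (space M) E \<and>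
     (\<exists>(Y :: (nat \<Rightarrow> real) topology) f. polish_topology Y \<and> f \<in> measurable M (borel_of_topology Y) \<and>
        (\<forall>x\<in>space M. \<forall>x'\<in>space M. (x, x') \<in> E \<longleftrightarrow> f x = f x'))"

end

(* Lifting z to the point (1, Re z, Im z, |z|^2) of R^4 turns degree 1 maps into restrictions of
   linear maps, so degree 1 homeomorphism becomes linear equivalence of compact subsets of a
   paraboloid. A compact set K is recorded by its support function s_K(h) = sup {h . x | x in K},
   and the invariants of K are the sets of finite tuples (s_K(S^T a_1), ..., s_K(S^T a_k)), where S
   runs over all matrices and the a_i over a countable dense set, tested against rational boxes.
   Openness in S makes each of these countably many conditions Borel. If K and L pass the same
   tests, compactness gives S with s_K(a) = s_L(S^T a) for all a, that is, K and S L have the same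
   convex hull, and the same holds with K and L exchanged. Every point of a subset of the
   paraboloid is an extreme point of its hull, so K is contained in S L and, symmetrically, L in
   T K; comparing dimensions, S is injective on the span of L, hence preserves extreme points, and
   S L = K.  *)
theory Submission
  imports Defs
begin

subsection \<open>Support functions of compact sets\<close>

text \<open>On the empty set the value is the unspecified real number \<open>Sup {}\<close>.\<close>

definition support_fun :: "'a::real_inner set \<Rightarrow> 'a \<Rightarrow> real" where
  "support_fun K h = (SUP x\<in>K. h \<bullet> x)"

lemma support_fun_bdd:
  fixes K :: "'a::euclidean_space set"
  assumes "compact K"
  shows "bdd_above ((\<lambda>x. h \<bullet> x) ` K)"
  by (intro bounded_imp_bdd_above compact_imp_bounded compact_continuous_image assms continuous_intros)

lemma support_fun_ge:
  fixes K :: "'a::euclidean_space set"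
  assumes "compact K" "x \<in> K"
  shows "h \<bullet> x \<le> support_fun K h"
  unfolding support_fun_def using assms by (intro cSUP_upper support_fun_bdd)

lemma support_fun_le:
  assumes "K \<noteq> {}" "\<And>x. x \<in> K \<Longrightarrow> h \<bullet> x \<le> c"
  shows "support_fun K h \<le> c"
  unfolding support_fun_def using assms by (intro cSUP_least) auto

lemma support_fun_less_iff:
  fixes K :: "'a::euclidean_space set"
  assumes "compact K" "K \<noteq> {}"
  shows "c < support_fun K h \<longleftrightarrow> (\<exists>x\<in>K. c < h \<bullet> x)"
  unfolding support_fun_def using assms by (intro less_cSUP_iff support_fun_bdd)

lemma support_fun_attained:
  fixes K :: "'a::euclidean_space set"
  assumes "compact K" "K \<noteq> {}"
  obtains x where "x \<in> K" "support_fun K h = h \<bullet> x"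
proof -
  have "continuous_on K (\<lambda>x. h \<bullet> x)" by (intro continuous_intros)
  then obtain x where "x \<in> K" "\<forall>y\<in>K. h \<bullet> y \<le> h \<bullet> x"
    using continuous_attains_sup[OF assms] by blast
  then show thesis
    using support_fun_ge[OF assms(1)] support_fun_le[OF assms(2)] by (intro that) (auto intro: antisym)
qed

text \<open>If \<open>R\<close> bounds the norms on \<open>K\<close>, replacing \<open>h\<close> by
  \<open>g\<close> changes each inner product with a point of \<open>K\<close> by at most
  \<open>R\<close> times their distance. Comparing the two values at a maximizer gives a Lipschitz
  estimate.\<close>

lemma continuous_on_support_fun:
  fixes K :: "'a::euclidean_space set"
  assumes "compact K" "K \<noteq> {}"
  shows "continuous_on A (support_fun K)"
proof -
  obtain R where R: "R > 0" "\<And>x. x \<in> K \<Longrightarrow> norm x \<le> R"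
    using compact_imp_bounded[OF assms(1)] bounded_pos by blast
  have *: "support_fun K h - support_fun K g \<le> R * dist h g" for h g
  proof -
    obtain x where x: "x \<in> K" "support_fun K h = h \<bullet> x"
      using support_fun_attained[OF assms] .
    have "(h - g) \<bullet> x \<le> norm (h - g) * norm x" by (rule norm_cauchy_schwarz)
    also have "\<dots> \<le> norm (h - g) * R" using R(2)[OF x(1)] by (intro mult_left_mono) auto
    finally show ?thesis
      using x support_fun_ge[OF assms(1) x(1), of g]
      by (simp add: inner_diff_left dist_norm mult.commute)
  qed
  have "R-lipschitz_on A (support_fun K)"
  proof (rule lipschitz_onI)
    show "dist (support_fun K h) (support_fun K g) \<le> R * dist h g" for h g
      using *[of h g] *[of g h] by (simp add: dist_real_def abs_le_iff dist_commute)
  qed (use R in simp)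
  then show ?thesis by (rule lipschitz_on_continuous_on)
qed

lemma support_fun_matrix_image:
  fixes B :: "real^'n^'m"
  shows "support_fun ((*v) B ` K) h = support_fun K (h v* B)"
  by (simp add: support_fun_def image_comp o_def dot_lmul_matrix)

text \<open>A point of \<open>K\<close> outside the compact hull of \<open>L\<close> could be
  strictly separated from it, and the support function of \<open>K\<close> would be the larger one
  in the separating direction.\<close>

lemma convex_hull_subset_if_support_fun_le:
  fixes K L :: "'a::euclidean_space set"
  assumes "compact K" "compact L" "L \<noteq> {}"
    and le: "\<And>h. support_fun K h \<le> support_fun L h"
  shows "convex hull K \<subseteq> convex hull L"
proof (rule hull_minimal)
  show "K \<subseteq> convex hull L"
  proof (rule ccontr)
    assume "\<not> K \<subseteq> convex hull L"
    then obtain x where x: "x \<in> K" "x \<notin> convex hull L" by blast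
    \<comment> \<open>The hull lies on the upper side of the hyperplane, so the contradiction arises
      in direction \<open>- a\<close>.\<close>
    obtain a b where ab: "a \<bullet> x < b" "\<forall>y\<in>convex hull L. b < a \<bullet> y"
      using separating_hyperplane_closed_point[OF convex_convex_hull _ x(2)] assms(2)
      by (auto simp: compact_convex_hull compact_imp_closed)
    have "- a \<bullet> x \<le> support_fun L (- a)"
      using support_fun_ge[OF assms(1) x(1)] le order_trans by blast
    also obtain y where "y \<in> L" "support_fun L (- a) = - a \<bullet> y"
      using support_fun_attained[OF assms(2,3)] .
    ultimately show False using ab hull_inc[of y L convex] by force
  qed
qed simp

text \<open>This later bounds the rows of matrices. The larger of the support values at
  \<open>h\<close> and \<open>- h\<close> is the maximum of \<open>\<bar>h \<bullet> x\<bar>\<close>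
  over \<open>K\<close>. It is continuous, and positive on the unit sphere of the span, since a
  vector of the span orthogonal to \<open>K\<close> is orthogonal to itself; \<open>m\<close> is its
  minimum there.\<close>

lemma inner_lower_bound_on_span:
  fixes K :: "'a::euclidean_space set"
  assumes "compact K" "K \<noteq> {}"
  obtains m where "m > 0" "\<And>h. h \<in> span K \<Longrightarrow> \<exists>x\<in>K. m * norm h \<le> \<bar>h \<bullet> x\<bar>"
proof -
  let ?f = "\<lambda>h. max (support_fun K h) (support_fun K (- h))"
  let ?T = "sphere 0 1 \<inter> span K"
  have f: "\<exists>x\<in>K. ?f h = \<bar>h \<bullet> x\<bar>" for h
  proof -
    obtain x where x: "x \<in> K" "support_fun K h = h \<bullet> x"
      using support_fun_attained[OF assms] .
    obtain y where y: "y \<in> K" "support_fun K (- h) = - h \<bullet> y"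
      using support_fun_attained[OF assms] .
    show ?thesis
      using support_fun_ge[OF assms(1) x(1), of "- h"] support_fun_ge[OF assms(1) y(1), of h] x y
      by (cases "support_fun K h \<le> support_fun K (- h)") (force simp: max_def)+
  qed
  have ge: "\<bar>h \<bullet> x\<bar> \<le> ?f h" if "x \<in> K" for h x
    using support_fun_ge[OF assms(1) that, of h] support_fun_ge[OF assms(1) that, of "- h"] by simp
  show thesis
  \<comment> \<open>An empty sphere means that the span is trivial, and then any positive constant
    works.\<close>
  proof (cases "?T = {}")
    case True
    have "h = 0" if "h \<in> span K" for h
    proof (rule ccontr)
      assume "h \<noteq> 0"
      then have "h /\<^sub>R norm h \<in> ?T" using that by (simp add: span_scale)
      with True show False by blast
    qed
    then show thesis using assms(2) by (intro that[of 1]) (auto, force)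
  next
    case False
    have "continuous_on ?T ?f"
      by (intro continuous_intros continuous_on_support_fun assms
          continuous_on_compose2[OF continuous_on_support_fun[OF assms, of UNIV]]) auto
    moreover have "compact ?T" by (intro compact_Int_closed closed_span) auto
    ultimately obtain u where u: "u \<in> ?T" "\<And>h. h \<in> ?T \<Longrightarrow> ?f u \<le> ?f h"
      using continuous_attains_inf[of ?T ?f] False by blast
    have "?f u > 0"
    proof (rule ccontr)
      assume "\<not> ?f u > 0"
      then have z: "u \<bullet> x = 0" if "x \<in> K" for x using ge[OF that, of u] by linarith
      have "orthogonal u u"
        by (rule orthogonal_to_span[of u K]) (use u z in \<open>auto simp: orthogonal_def\<close>)
      then show False using u by (auto simp: orthogonal_def)
    qed
    moreover have "\<exists>x\<in>K. ?f u * norm h \<le> \<bar>h \<bullet> x\<bar>" if "h \<in> span K" for h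
    proof (cases "h = 0")
      case True then show ?thesis using assms by auto
    next
      case False
      let ?g = "h /\<^sub>R norm h"
      have "?g \<in> ?T" using that False by (simp add: span_scale)
      then obtain x where x: "x \<in> K" "?f u \<le> \<bar>?g \<bullet> x\<bar>" using u(2) f by metis
      have "\<bar>?g \<bullet> x\<bar> = \<bar>h \<bullet> x\<bar> / norm h" by (simp add: abs_mult divide_inverse_commute)
      with x have "?f u * norm h \<le> \<bar>h \<bullet> x\<bar>" using False by (simp only: pos_le_divide_eq zero_less_norm_iff not_False_eq_True)
      with x(1) show ?thesis by blast
    qed
    ultimately show thesis by (rule that)
  qed
qed

text \<open>A basis of \<open>K\<close> lifts to an independent subset \<open>C\<close> of
  \<open>L\<close> with \<open>dim K\<close> elements. The dimension bound forces \<open>C\<close>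
  to span \<open>L\<close>, and \<open>f\<close> is injective on the span of \<open>C\<close>
  because it maps \<open>C\<close> bijectively onto an independent set.\<close>

lemma inj_on_span_if_subset_image:
  fixes f :: "'a::euclidean_space \<Rightarrow> 'b::euclidean_space"
  assumes f: "linear f" and sub: "K \<subseteq> f ` L" and dim: "dim L \<le> dim K"
  shows "inj_on f (span L)"
proof -
  obtain B where B: "B \<subseteq> K" "independent B" "K \<subseteq> span B" "card B = dim K"
    using basis_exists .
  obtain C where C: "C \<subseteq> L" "inj_on f C" "B = f ` C"
    using B(1) sub subset_image_inj[of B f L] by blast
  obtain g where g: "linear g" "\<And>b. b \<in> B \<Longrightarrow> g b = inv_into C f b"
    using linear_independent_extend[OF B(2)] by blast
  \<comment> \<open>Having \<open>f\<close> as a left inverse makes \<open>g\<close> injective on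
    the span of \<open>B\<close>, so independence passes from \<open>B\<close> to
    \<open>C\<close>.\<close>
  have "(f \<circ> g) b = b" if "b \<in> span B" for b
    using linear_eq_on_span[OF linear_compose[OF g(1) f] linear_id _ that] g C
    by (force simp: f_inv_into_f)
  then have "inj_on g (span B)" by (auto intro: inj_on_inverseI)
  moreover have "g ` B = C" using g(2) C by (auto simp: image_image)
  ultimately have ind: "independent C"
    using linear_independent_injective_image[OF g(1) B(2)] by simp
  have "card C = dim K" using B(4) C by (simp add: card_image)
  then have "L \<subseteq> span C"
    using dim C(1) ind by (intro card_ge_dim_independent) auto
  then have "span L \<subseteq> span C" by (simp add: span_minimal)
  moreover have "inj_on f (span C)"
    using linear_inj_on_span_independent_image[OF f] B(2) C by blast
  ultimately show ?thesis by (rule inj_on_subset[rotated])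
qed

section \<open>Solving for a matrix by compactness\<close>

lemma continuous_on_vector_matrix_mult_left: "continuous_on A (\<lambda>a. a v* (S :: real^'n^'m))"
  unfolding vector_matrix_mult_def by (intro continuous_intros)

lemma continuous_on_vector_matrix_mult: "continuous_on A (\<lambda>S :: real^'n^'m. a v* S)"
  unfolding vector_matrix_mult_def by (intro continuous_intros)

text \<open>Projecting each row orthogonally onto the span of \<open>L\<close> keeps its inner
  products with the points of \<open>L\<close>. This normalization removes the unbounded freedom in
  the choice of a matrix with given values on \<open>L\<close>.\<close>

lemma matrix_rows_in_span:
  fixes S :: "real^'n^'m"
  obtains S' :: "real^'n^'m" where "\<And>i. S' $ i \<in> span L" "\<And>x. x \<in> L \<Longrightarrow> S' *v x = S *v x"
proof -
  have "\<exists>y. y \<in> span L \<and> (\<forall>x\<in>L. y \<bullet> x = S $ i \<bullet> x)" for i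
  proof -
    obtain y z where yz: "y \<in> span L" "\<And>w. w \<in> span L \<Longrightarrow> orthogonal z w" "S $ i = y + z"
      using orthogonal_subspace_decomp_exists[of L "S $ i"] by metis
    then show ?thesis by (intro exI[of _ y]) (auto simp: inner_add_left orthogonal_def span_base)
  qed
  then obtain y where y: "\<And>i. y i \<in> span L" "\<And>i x. x \<in> L \<Longrightarrow> y i \<bullet> x = S $ i \<bullet> x" by metis
  show thesis
    by (rule that[of "\<chi> i. y i"]) (auto simp: vec_eq_iff matrix_vector_mul_component y)
qed

text \<open>The sets \<open>F n\<close> of normalized solutions up to \<open>1 / Suc n\<close> are
  compact, nonempty and decreasing. A common point is exact on \<open>X\<close>, and then everywhere
  by density and continuity.\<close>

lemma exists_matrix_support_fun:
  fixes K :: "(real^'m) set" and L :: "(real^'n) set"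
  assumes K: "compact K" "K \<noteq> {}" and L: "compact L" "L \<noteq> {}"
    and X: "countable X" "closure X = UNIV" "\<And>i. axis i 1 \<in> X" "\<And>i. - axis i 1 \<in> X"
    and approx: "\<And>T e. finite T \<Longrightarrow> T \<subseteq> X \<Longrightarrow> e > 0 \<Longrightarrow>
      \<exists>S :: real^'n^'m. \<forall>a\<in>T. \<bar>support_fun L (a v* S) - support_fun K a\<bar> < e"
  obtains S :: "real^'n^'m" where "\<And>a. support_fun L (a v* S) = support_fun K a"
proof -
  define x where "x = from_nat_into X"
  \<comment> \<open>These directions are tested at every stage: the axis vectors and their negatives
    pick out the rows of \<open>S\<close> and their negatives, which bounds the rows from both sides
    on \<open>L\<close>.\<close>
  define Ax :: "(real^'m) set" where "Ax = range (\<lambda>i. axis i 1) \<union> range (\<lambda>i. - axis i 1)"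
  have X': "X \<noteq> {}" using X(3) by blast
  then have x: "range x = X" unfolding x_def using X(1) by (rule range_from_nat_into)
  define F where "F n = {S :: real^'n^'m. (\<forall>i. S $ i \<in> span L) \<and>
    (\<forall>a\<in>Ax \<union> x ` {..n}. \<bar>support_fun L (a v* S) - support_fun K a\<bar> \<le> 1 / Suc n)}" for n
  have cont: "continuous_on UNIV (\<lambda>S. support_fun L (a v* S))" for a :: "real^'m"
    by (rule continuous_on_compose2[OF continuous_on_support_fun[OF L] continuous_on_vector_matrix_mult]) auto
  obtain m where m: "m > 0" "\<And>h. h \<in> span L \<Longrightarrow> \<exists>x\<in>L. m * norm h \<le> \<bar>h \<bullet> x\<bar>"
    by (rule inner_lower_bound_on_span[OF L]) blast
  have "compact (F n)" for n
  proof -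
    have "F n = (\<Inter>i. (\<lambda>S. S $ i) -` span L) \<inter>
        (\<Inter>a\<in>Ax \<union> x ` {..n}. {S. \<bar>support_fun L (a v* S) - support_fun K a\<bar> \<le> 1 / Suc n})"
      by (auto simp: F_def)
    also have "closed \<dots>"
      by (intro closed_Int closed_INT ballI closed_vimage closed_span closed_Collect_le
          continuous_intros cont)
    finally have "closed (F n)" .
    moreover have "bounded (F n)"
    proof -
      \<comment> \<open>The tolerance is at most 1, whence the summand 1; dividing by
        \<open>m\<close> turns a bound on \<open>\<bar>S $ i \<bullet> x\<bar>\<close> into one on
        the norm of the row.\<close>
      define c where "c i = (\<bar>support_fun K (axis i 1)\<bar> + \<bar>support_fun K (- axis i 1)\<bar> + 1) / m" for i
      have "norm (S $ i) \<le> c i" if S: "S \<in> F n" for S i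
      proof -
        obtain x where x: "x \<in> L" "m * norm (S $ i) \<le> \<bar>S $ i \<bullet> x\<bar>"
          using m(2) S unfolding F_def by blast
        have row: "axis i 1 v* S = S $ i" "(- axis i 1) v* S = - S $ i"
          by (simp_all add: vec_eq_iff vector_matrix_mult_def axis_def if_distrib if_distribR cong: if_cong)
        have "\<bar>support_fun L (a v* S) - support_fun K a\<bar> \<le> 1" if "a \<in> Ax" for a
        proof -
          have "\<bar>support_fun L (a v* S) - support_fun K a\<bar> \<le> 1 / Suc n"
            using S that unfolding F_def by blast
          also have "\<dots> \<le> 1" by simp
          finally show ?thesis .
        qed
        from this[of "axis i 1"] this[of "- axis i 1"]
        have "support_fun L (S $ i) \<le> support_fun K (axis i 1) + 1"
          "support_fun L (- S $ i) \<le> support_fun K (- axis i 1) + 1"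
          unfolding row by (auto simp: Ax_def)
        then have "\<bar>S $ i \<bullet> x\<bar> \<le> \<bar>support_fun K (axis i 1)\<bar> + \<bar>support_fun K (- axis i 1)\<bar> + 1"
          using support_fun_ge[OF L(1) x(1), of "S $ i"] support_fun_ge[OF L(1) x(1), of "- S $ i"]
          by simp
        with x(2) m(1) show ?thesis by (simp add: c_def pos_le_divide_eq mult.commute)
      qed
      then have "norm S \<le> (\<Sum>i\<in>UNIV. c i)" if "S \<in> F n" for S
        unfolding norm_vec_def[of S] using that
        by (intro order_trans[OF L2_set_le_sum[of UNIV "\<lambda>i. norm (S $ i)"]] sum_mono) auto
      then show ?thesis by (auto simp: bounded_iff)
    qed
    ultimately show ?thesis by (simp add: compact_eq_bounded_closed)
  qed
  moreover have "F n \<noteq> {}" for n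
  proof -
    have "finite (Ax \<union> x ` {..n})" "Ax \<union> x ` {..n} \<subseteq> X" using x X by (auto simp: Ax_def)
    from approx[OF this, of "1 / Suc n"] obtain S :: "real^'n^'m"
      where S: "\<forall>a\<in>Ax \<union> x ` {..n}. \<bar>support_fun L (a v* S) - support_fun K a\<bar> < 1 / Suc n" by auto
    obtain S' :: "real^'n^'m" where S': "\<And>i. S' $ i \<in> span L" "\<And>x. x \<in> L \<Longrightarrow> S' *v x = S *v x"
      by (rule matrix_rows_in_span[of L S]) blast
    have "support_fun L (a v* S') = support_fun L (a v* S)" for a
      unfolding support_fun_def by (intro SUP_cong) (auto simp: dot_lmul_matrix S')
    with S S' have "S' \<in> F n" unfolding F_def by (auto intro: less_imp_le)
    then show ?thesis by blast
  qed
  moreover have "F n \<subseteq> F k" if "k \<le> n" for k n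
  proof -
    have "1 / real (Suc n) \<le> 1 / real (Suc k)" using that by (simp add: frac_le)
    then show ?thesis using that unfolding F_def by (auto intro: order_trans)
  qed
  ultimately have "\<Inter>(range F) \<noteq> {}" by (rule compact_nest)
  then obtain S where S: "\<And>n. S \<in> F n" by blast
  have eq: "support_fun L (a v* S) = support_fun K a" if "a \<in> X" for a
  proof -
    obtain k where k: "a = x k" using \<open>a \<in> X\<close> x by blast
    \<comment> \<open>The direction \<open>x k\<close> is tested from stage \<open>k\<close> on,
      with tolerances tending to 0.\<close>
    have "\<bar>support_fun L (a v* S) - support_fun K a\<bar> \<le> 1 / Suc n" if "n \<ge> k" for n
      using S[of n] k that unfolding F_def by blast
    then have "\<bar>support_fun L (a v* S) - support_fun K a\<bar> \<le> 0"
      by (intro LIMSEQ_le_const[OF LIMSEQ_inverse_real_of_nat]) (auto simp: inverse_eq_divide intro!: exI[of _ k])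
    then show ?thesis by simp
  qed
  have "support_fun L (a v* S) = support_fun K a" for a
  proof -
    have "closed {a. support_fun L (a v* S) = support_fun K a}"
      by (intro closed_Collect_eq continuous_on_support_fun K continuous_on_vector_matrix_mult_left
          continuous_on_compose2[OF continuous_on_support_fun[OF L, of UNIV]]) auto
    then have "closure X \<subseteq> {a. support_fun L (a v* S) = support_fun K a}"
      by (intro closure_minimal) (auto simp: eq)
    then show ?thesis using X(2) by blast
  qed
  then show thesis by (rule that)
qed

subsection \<open>Degree 1 maps as linear maps of the paraboloid\<close>

lemma matrix_image_eq_if_support_fun:
  fixes K :: "(real^'m) set" and L :: "(real^'n) set"
  assumes K: "compact K" "K \<noteq> {}" and L: "compact L" "L \<noteq> {}"
    and indK: "\<And>a. a \<in> K \<Longrightarrow> a \<notin> convex hull (K - {a})"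
    and indL: "\<And>a. a \<in> L \<Longrightarrow> a \<notin> convex hull (L - {a})"
    and S: "\<And>a. support_fun L (a v* S) = support_fun K a"
    and T: "\<And>a. support_fun K (a v* T) = support_fun L a"
  shows "(*v) S ` L = K" "inj_on ((*v) S) (span L)"
proof -
  have compact_im: "compact ((*v) S ` L)" "compact ((*v) T ` K)"
    using K L by (auto intro!: compact_continuous_image matrix_vector_mult_linear_continuous_on)
  have hull: "convex hull ((*v) S ` L) = convex hull K"
    using K L compact_im
    by (intro subset_antisym convex_hull_subset_if_support_fun_le) (auto simp: support_fun_matrix_image S)
  have hull': "convex hull ((*v) T ` K) = convex hull L"
    using K L compact_im
    by (intro subset_antisym convex_hull_subset_if_support_fun_le) (auto simp: support_fun_matrix_image T)
  have extK: "{x. x extreme_point_of convex hull K} = K"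
    using extreme_point_of_convex_hull_convex_independent[OF K(1) indK] by blast
  have extL: "{x. x extreme_point_of convex hull L} = L"
    using extreme_point_of_convex_hull_convex_independent[OF L(1) indL] by blast
  \<comment> \<open>Extreme points of the hull of a set belong to the set, and convex independence
    makes every point of \<open>K\<close> extreme in the common hull.\<close>
  have "K \<subseteq> (*v) S ` L"
    using extreme_points_of_convex_hull[of "(*v) S ` L"] unfolding hull extK .
  moreover have "L \<subseteq> (*v) T ` K"
    using extreme_points_of_convex_hull[of "(*v) T ` K"] unfolding hull' extL .
  then have "dim L \<le> dim K"
    by (meson dim_image_le dim_subset matrix_vector_mul_linear order_trans)
  ultimately show inj: "inj_on ((*v) S) (span L)"
    by (intro inj_on_span_if_subset_image) auto
  \<comment> \<open>A representation of \<open>S *v y\<close> by the other image points lifts to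
    some \<open>u\<close> in the hull of \<open>L - {y}\<close>; injectivity on the span gives
    \<open>u = y\<close>, against the convex independence of \<open>L\<close>.\<close>
  have "S *v y \<notin> convex hull ((*v) S ` L - {S *v y})" if y: "y \<in> L" for y
  proof
    assume *: "S *v y \<in> convex hull ((*v) S ` L - {S *v y})"
    have "(*v) S ` L - {S *v y} \<subseteq> (*v) S ` (L - {y})" by auto
    then have "S *v y \<in> convex hull ((*v) S ` (L - {y}))" using * hull_mono by blast
    then obtain u where u: "u \<in> convex hull (L - {y})" "S *v y = S *v u"
      by (auto simp: convex_hull_linear_image[symmetric])
    have "u \<in> span L" using u(1) convex_hull_subset_span hull_mono[of "L - {y}" L convex] by blast
    then have "y = u" using inj u(2) y by (auto dest: inj_onD simp: span_base)
    with u(1) indL y show False by blast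
  qed
  then have "{x. x extreme_point_of convex hull ((*v) S ` L)} = (*v) S ` L"
    using extreme_point_of_convex_hull_convex_independent[OF compact_im(1)] by blast
  then show "(*v) S ` L = K" unfolding hull extK by simp
qed

section \<open>The lift to the paraboloid\<close>

lemma vector_4 [simp]:
  "(vector [x, y, z, w] :: 'a::zero^4) $ 1 = x"
  "(vector [x, y, z, w] :: 'a::zero^4) $ 2 = y"
  "(vector [x, y, z, w] :: 'a::zero^4) $ 3 = z"
  "(vector [x, y, z, w] :: 'a::zero^4) $ 4 = w"
  unfolding vector_def by simp_all

text \<open>The coordinates have the same complex span as 1, \<open>z\<close>, \<open>cnj z\<close>
  and \<open>z * cnj z\<close>; the leading 1 makes constant terms linear.\<close>

definition paraboloid :: "complex \<Rightarrow> real^4" where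
  "paraboloid z = vector [1, Re z, Im z, (cmod z)\<^sup>2]"

lemma paraboloid_nth [simp]:
  "paraboloid z $ 1 = 1" "paraboloid z $ 2 = Re z" "paraboloid z $ 3 = Im z" "paraboloid z $ 4 = (cmod z)\<^sup>2"
  by (simp_all add: paraboloid_def)

lemma paraboloid_eq_iff [simp]: "paraboloid z = paraboloid w \<longleftrightarrow> z = w"
  by (metis complex_eqI paraboloid_nth(2,3))

lemma continuous_on_paraboloid: "continuous_on A paraboloid"
proof -
  have eq: "paraboloid = (\<lambda>z. 1 *\<^sub>R axis 1 1 + Re z *\<^sub>R axis 2 1 + Im z *\<^sub>R axis 3 1 + (cmod z)\<^sup>2 *\<^sub>R axis 4 1)"
    by (auto simp: fun_eq_iff vec_eq_iff forall_4 axis_def)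
  show ?thesis unfolding eq by (intro continuous_intros)
qed

lemma compact_paraboloid_image: "compact D \<Longrightarrow> compact (paraboloid ` D)"
  by (rule compact_continuous_image[OF continuous_on_paraboloid])

lemma paraboloid_convex_independent:
  assumes "a \<in> paraboloid ` D"
  shows "a \<notin> convex hull (paraboloid ` D - {a})"
proof -
  obtain z where a: "a = paraboloid z" using assms by blast
  \<comment> \<open>This functional defines the tangent hyperplane of the paraboloid at
    \<open>a\<close>: on lifted points it is the squared distance to \<open>z\<close>, so it
    vanishes at \<open>a\<close> and is positive at all other points of the lift.\<close>
  define l :: "real^4" where "l = vector [(cmod z)\<^sup>2, - 2 * Re z, - 2 * Im z, 1]"
  have l: "l \<bullet> paraboloid u = (cmod (u - z))\<^sup>2" for u
    by (simp add: l_def inner_vec_def sum_4 cmod_power2) (simp add: power2_eq_square algebra_simps)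
  have "convex hull (paraboloid ` D - {a}) \<subseteq> {x. 0 < l \<bullet> x}"
    by (rule hull_minimal) (auto simp: l a convex_halfspace_gt)
  then show ?thesis by (auto simp: a l)
qed

text \<open>The form of \<open>f\<close> supplies the rows for the real and imaginary parts, and the
  form of \<open>f z * cnj (f z)\<close>, the squared modulus, supplies the last row.\<close>

lemma degree1_map_iff:
  "degree1_map D f \<longleftrightarrow> (\<exists>A :: real^4^4. \<forall>z\<in>D. paraboloid (f z) = A *v paraboloid z)"
proof
  assume "degree1_map D f"
  then obtain \<alpha> \<beta> \<gamma> \<delta> \<alpha>' \<beta>' \<gamma>' \<delta>' where
    f: "\<And>z. z \<in> D \<Longrightarrow> f z = \<alpha> + \<beta> * z + \<gamma> * cnj z + \<delta> * z * cnj z" and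
    ff: "\<And>z. z \<in> D \<Longrightarrow> f z * cnj (f z) = \<alpha>' + \<beta>' * z + \<gamma>' * cnj z + \<delta>' * z * cnj z"
    unfolding degree1_map_def deg1_form_def by metis
  define A :: "real^4^4" where "A = vector [vector [1, 0, 0, 0],
    vector [Re \<alpha>, Re \<beta> + Re \<gamma>, Im \<gamma> - Im \<beta>, Re \<delta>],
    vector [Im \<alpha>, Im \<beta> + Im \<gamma>, Re \<beta> - Re \<gamma>, Im \<delta>],
    vector [Re \<alpha>', Re \<beta>' + Re \<gamma>', Im \<gamma>' - Im \<beta>', Re \<delta>']]"
  have "paraboloid (f z) = A *v paraboloid z" if "z \<in> D" for z
  proof -
    have sq: "(cmod (f z))\<^sup>2 = Re (\<alpha>' + \<beta>' * z + \<gamma>' * cnj z + \<delta>' * z * cnj z)"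
      unfolding ff[OF that, symmetric] cmod_power2 by (simp add: power2_eq_square)
    show ?thesis
      unfolding vec_eq_iff forall_4 paraboloid_nth sq
      by (simp add: A_def matrix_vector_mult_def sum_4 f[OF that] cmod_power2)
        (simp add: power2_eq_square algebra_simps)
  qed
  then show "\<exists>A :: real^4^4. \<forall>z\<in>D. paraboloid (f z) = A *v paraboloid z" by blast
next
  assume "\<exists>A :: real^4^4. \<forall>z\<in>D. paraboloid (f z) = A *v paraboloid z"
  then obtain A :: "real^4^4" where A: "\<And>z. z \<in> D \<Longrightarrow> paraboloid (f z) = A *v paraboloid z" by blast
  have row: "(A *v paraboloid z) $ i = A$i$1 + A$i$2 * Re z + A$i$3 * Im z + A$i$4 * (cmod z)\<^sup>2" for z i
    by (simp add: matrix_vector_mult_def sum_4)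
  have comp: "Re (f z) = A$2$1 + A$2$2 * Re z + A$2$3 * Im z + A$2$4 * (cmod z)\<^sup>2"
    "Im (f z) = A$3$1 + A$3$2 * Re z + A$3$3 * Im z + A$3$4 * (cmod z)\<^sup>2"
    "(cmod (f z))\<^sup>2 = A$4$1 + A$4$2 * Re z + A$4$3 * Im z + A$4$4 * (cmod z)\<^sup>2" if "z \<in> D" for z
    unfolding paraboloid_nth[symmetric, of "f z"] A[OF that] row by simp_all
  \<comment> \<open>Substituting the expressions of \<open>Re z\<close> and \<open>Im z\<close> in
    \<open>z\<close> and \<open>cnj z\<close> gives the coefficients. They are complex so that the
    claim covers both \<open>f\<close> and its squared modulus.\<close>
  have form: "deg1_form D g" if "\<And>z. z \<in> D \<Longrightarrow> g z = a + b * Re z + c * Im z + d * (cmod z)\<^sup>2"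
    for g :: "complex \<Rightarrow> complex" and a b c d :: complex
  proof -
    have "\<forall>z\<in>D. g z = a + (b - \<i> * c) / 2 * z + (b + \<i> * c) / 2 * cnj z + d * z * cnj z"
      by (auto simp: that complex_eq_iff cmod_power2) (auto simp: power2_eq_square field_simps)
    then show ?thesis unfolding deg1_form_def by blast
  qed
  have "deg1_form D f"
    by (rule form[of _ "Complex (A$2$1) (A$3$1)" "Complex (A$2$2) (A$3$2)" "Complex (A$2$3) (A$3$3)"
          "Complex (A$2$4) (A$3$4)"]) (simp add: complex_eq_iff comp)
  moreover have "deg1_form D (\<lambda>z. f z * cnj (f z))"
    by (rule form[of _ "A$4$1" "A$4$2" "A$4$3" "A$4$4"])
      (simp flip: complex_norm_square of_real_mult of_real_add of_real_power add: comp)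
  ultimately show "degree1_map D f" by (simp add: degree1_map_def)
qed

section \<open>Degree 1 homeomorphism as an equivalence relation and as linear equivalence\<close>

lemma degree1_homeomorphic_refl: "degree1_homeomorphic D D"
proof -
  have "degree1_map D (\<lambda>z. z)"
    unfolding degree1_map_iff by (rule exI[of _ "mat 1"]) simp
  then have "degree1_homeomorphism D D (\<lambda>z. z) (\<lambda>z. z)"
    by (simp add: degree1_homeomorphism_def homeomorphism_def)
  then show ?thesis unfolding degree1_homeomorphic_def by blast
qed

lemma degree1_homeomorphic_sym: "degree1_homeomorphic D D' \<Longrightarrow> degree1_homeomorphic D' D"
  unfolding degree1_homeomorphic_def degree1_homeomorphism_def using homeomorphism_symD by blast

text \<open>Substituting the polynomial formulas would raise the degree; on the lifts, composition
  is just the matrix product.\<close>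

lemma degree1_map_compose:
  assumes "degree1_map D f" "degree1_map D' g" "f ` D \<subseteq> D'"
  shows "degree1_map D (g \<circ> f)"
proof -
  obtain A B :: "real^4^4" where "\<forall>z\<in>D. paraboloid (f z) = A *v paraboloid z"
    "\<forall>z\<in>D'. paraboloid (g z) = B *v paraboloid z"
    using assms unfolding degree1_map_iff by blast
  then show ?thesis
    using assms(3) unfolding degree1_map_iff
    by (intro exI[of _ "B ** A"]) (auto simp: matrix_vector_mul_assoc[symmetric] image_subset_iff)
qed

lemma degree1_homeomorphic_trans:
  assumes "degree1_homeomorphic D D'" "degree1_homeomorphic D' D''"
  shows "degree1_homeomorphic D D''"
proof -
  obtain f g f' g' where fg: "degree1_homeomorphism D D' f g" "degree1_homeomorphism D' D'' f' g'"
    using assms unfolding degree1_homeomorphic_def by blast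
  then have "homeomorphism D D'' (f' \<circ> f) (g \<circ> g')"
    unfolding degree1_homeomorphism_def by (blast intro: homeomorphism_compose)
  moreover have "degree1_map D (f' \<circ> f)" "degree1_map D'' (g \<circ> g')"
    using fg unfolding degree1_homeomorphism_def
    by (auto intro!: degree1_map_compose[where D' = D'] simp: homeomorphism_def)
  ultimately have "degree1_homeomorphism D D'' (f' \<circ> f) (g \<circ> g')"
    by (simp add: degree1_homeomorphism_def)
  then show ?thesis unfolding degree1_homeomorphic_def by blast
qed

lemma equiv_degree1_rel: "equiv {K. compact K} degree1_rel"
  unfolding degree1_rel_def
  by (rule equivI) (auto intro!: refl_onI symI transI degree1_homeomorphic_refl
      dest: degree1_homeomorphic_sym intro: degree1_homeomorphic_trans)

lemma degree1_map_continuous: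
  assumes "degree1_map D f"
  shows "continuous_on D f"
proof -
  obtain a b c d where "\<And>z. z \<in> D \<Longrightarrow> f z = a + b * z + c * cnj z + d * z * cnj z"
    using assms unfolding degree1_map_def deg1_form_def by blast
  moreover have "continuous_on D (\<lambda>z. a + b * z + c * cnj z + d * z * cnj z)" by (intro continuous_intros)
  ultimately show ?thesis by (simp cong: continuous_on_cong)
qed

text \<open>Since the lift is injective, \<open>S\<close> induces a bijection from \<open>L\<close>
  to \<open>D\<close>. A linear left inverse of \<open>S\<close> on the span provides the matrix for
  the inverse map, and degree 1 maps are continuous.\<close>

lemma degree1_homeomorphicI:
  fixes S :: "real^4^4"
  assumes im: "(*v) S ` paraboloid ` L = paraboloid ` D" and inj: "inj_on ((*v) S) (span (paraboloid ` L))"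
  shows "degree1_homeomorphic L D"
proof -
  obtain g where g: "linear g" "\<And>x. x \<in> span (paraboloid ` L) \<Longrightarrow> g (S *v x) = x"
    using linear_exists_left_inverse_on[OF matrix_vector_mul_linear subspace_span inj] by blast
  define T where "T = matrix g"
  have T: "T *v (S *v paraboloid w) = paraboloid w" if "w \<in> L" for w
    using g(2)[of "paraboloid w"] that by (simp add: T_def matrix_vector_mul(2)[OF g(1)] span_base)
  have "\<exists>z\<in>D. paraboloid z = S *v paraboloid w" if "w \<in> L" for w
    using that imageI[of "paraboloid w" "paraboloid ` L" "(*v) S"] unfolding im by force
  then obtain \<phi> where \<phi>: "\<And>w. w \<in> L \<Longrightarrow> \<phi> w \<in> D" "\<And>w. w \<in> L \<Longrightarrow> paraboloid (\<phi> w) = S *v paraboloid w"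
    by metis
  have "\<exists>w\<in>L. paraboloid z = S *v paraboloid w" if "z \<in> D" for z
    using imageI[OF that, of paraboloid] unfolding im[symmetric] by blast
  then have "\<forall>z\<in>D. \<exists>w\<in>L. paraboloid w = T *v paraboloid z \<and> paraboloid z = S *v paraboloid w"
    using T by metis
  then obtain \<psi> where \<psi>: "\<And>z. z \<in> D \<Longrightarrow> \<psi> z \<in> L" "\<And>z. z \<in> D \<Longrightarrow> paraboloid (\<psi> z) = T *v paraboloid z"
    "\<And>z. z \<in> D \<Longrightarrow> paraboloid z = S *v paraboloid (\<psi> z)"
    by metis
  have "degree1_map L \<phi>" "degree1_map D \<psi>" unfolding degree1_map_iff using \<phi> \<psi> by blast+
  moreover have "\<psi> (\<phi> w) = w" if "w \<in> L" for w
    using \<psi>(2)[OF \<phi>(1)[OF that]] \<phi>(2)[OF that] T[OF that] by simp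
  moreover have "\<phi> (\<psi> z) = z" if "z \<in> D" for z
    using \<phi>(2)[OF \<psi>(1)[OF that]] \<psi>(3)[OF that] by (metis paraboloid_eq_iff)
  ultimately have "degree1_homeomorphism L D \<phi> \<psi>"
    unfolding degree1_homeomorphism_def
    by (auto intro!: homeomorphismI degree1_map_continuous \<phi>(1) \<psi>(1))
  then show ?thesis unfolding degree1_homeomorphic_def by blast
qed

lemma degree1_homeomorphic_support_fun:
  assumes "degree1_homeomorphic D L"
  obtains B :: "real^4^4" where "\<And>h. support_fun (paraboloid ` L) h = support_fun (paraboloid ` D) (h v* B)"
proof -
  obtain \<phi> \<psi> where \<phi>: "degree1_homeomorphism D L \<phi> \<psi>" using assms unfolding degree1_homeomorphic_def by blast
  then obtain B :: "real^4^4" where B: "\<forall>z\<in>D. paraboloid (\<phi> z) = B *v paraboloid z"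
    unfolding degree1_homeomorphism_def degree1_map_iff by blast
  have "paraboloid ` L = paraboloid ` \<phi> ` D" using \<phi> by (simp add: degree1_homeomorphism_def homeomorphism_def)
  also have "\<dots> = (*v) B ` paraboloid ` D" using B by (auto simp: image_image)
  finally show thesis by (intro that) (simp add: support_fun_matrix_image)
qed

subsection \<open>Borel invariants\<close>

lemma closure_eq_UNIV_if_dense:
  assumes "\<And>U. open U \<Longrightarrow> U \<noteq> {} \<Longrightarrow> \<exists>d\<in>C. d \<in> U"
  shows "closure C = UNIV"
  using assms[of "- closure C"] closure_subset by blast

text \<open>The classifying map sends a point to the sequence of its memberships in the sets of
  \<open>\<A>\<close>, as an element of the Polish space of all real sequences.\<close>

lemma smooth_equivalenceI:
  assumes "equiv (space M) E" "countable \<A>" "\<A> \<subseteq> sets M"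
    and sep: "\<And>x y. x \<in> space M \<Longrightarrow> y \<in> space M \<Longrightarrow> (x, y) \<in> E \<longleftrightarrow> (\<forall>A\<in>\<A>. x \<in> A \<longleftrightarrow> y \<in> A)"
  shows "smooth_equivalence M E"
proof -
  \<comment> \<open>Adding the empty set allows an enumeration even if \<open>\<A>\<close> is empty,
    and separates no points.\<close>
  define A where "A = from_nat_into (insert {} \<A>)"
  have A: "range A = insert {} \<A>"
    unfolding A_def using assms(2) by (intro range_from_nat_into) auto
  define f :: "'a \<Rightarrow> nat \<Rightarrow> real" where "f x n = indicator (A n) x" for x n
  have "A n \<in> sets M" for n using A assms(3) by (metis insertE rangeI sets.empty_sets subsetD)
  then have "f \<in> borel_measurable M"
    unfolding f_def by (intro measurable_coordinatewise_then_product borel_measurable_indicator)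
  moreover have "borel_of_topology (euclidean :: (nat \<Rightarrow> real) topology) = borel"
    by (simp add: borel_of_topology_def borel_def)
  moreover have "polish_topology (euclidean :: (nat \<Rightarrow> real) topology)"
    unfolding polish_topology_def
  proof
    obtain C :: "(nat \<Rightarrow> real) set" where C: "countable C" "\<And>X. open X \<Longrightarrow> X \<noteq> {} \<Longrightarrow> \<exists>d\<in>C. d \<in> X"
      using countable_dense_setE by blast
    then have "closure C = UNIV" by (intro closure_eq_UNIV_if_dense)
    then show "separable_space (euclidean :: (nat \<Rightarrow> real) topology)"
      using C(1) by (auto simp: separable_space_def)
  qed (rule completely_metrizable_space_euclidean)
  moreover have "(x, y) \<in> E \<longleftrightarrow> f x = f y" if "x \<in> space M" "y \<in> space M" for x y
  proof -
    have "(x, y) \<in> E \<longleftrightarrow> (\<forall>B\<in>range A. x \<in> B \<longleftrightarrow> y \<in> B)"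
      using sep[OF that] by (simp add: A)
    also have "\<dots> \<longleftrightarrow> f x = f y"
      by (auto simp: f_def fun_eq_iff indicator_def split: if_splits)
    finally show ?thesis .
  qed
  ultimately show ?thesis
    unfolding smooth_equivalence_def using assms(1) by metis
qed

section \<open>Measurability on the space of compact sets\<close>

lemma space_compacts_borel: "space (compacts_borel :: 'a::t2_space set measure) = {K. compact K}"
  by (auto simp: compacts_borel_def effros_borel_def space_restrict_space space_measure_of_conv compact_imp_closed)

lemma hitting_set_measurable:
  fixes U :: "'a::t2_space set"
  assumes "open U"
  shows "{K \<in> space compacts_borel. K \<inter> U \<noteq> {}} \<in> sets compacts_borel"
proof -
  have "{F. closed F \<and> F \<inter> U \<noteq> {}} \<in> sets effros_borel"
    unfolding effros_borel_def using assms by (subst sets_measure_of) auto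
  then have "{K. compact K} \<inter> {F. closed F \<and> F \<inter> U \<noteq> {}} \<in> sets compacts_borel"
    unfolding compacts_borel_def sets_restrict_space by blast
  also have "{K. compact K} \<inter> {F. closed F \<and> F \<inter> U \<noteq> {}} = {K \<in> space compacts_borel. K \<inter> U \<noteq> {}}"
    by (auto simp: space_compacts_borel compact_imp_closed)
  finally show ?thesis .
qed

lemma nonempty_measurable: "{K \<in> space compacts_borel. K \<noteq> {}} \<in> sets (compacts_borel :: 'a::t2_space set measure)"
  using hitting_set_measurable[of "UNIV :: 'a set"] by simp

text \<open>For nonempty \<open>K\<close> the value exceeds \<open>c\<close> exactly if
  \<open>K\<close> meets the open set of points whose lift has inner product with \<open>h\<close>
  above \<open>c\<close>.\<close>

lemma support_fun_measurable:
  "(\<lambda>K. support_fun (paraboloid ` K) h) \<in> borel_measurable compacts_borel"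
proof (rule borel_measurableI_greater)
  fix c
  let ?U = "{z. c < h \<bullet> paraboloid z}"
  \<comment> \<open>The empty set has an unspecified value, so it is added to the superlevel set or
    not according to \<open>c < ?e\<close>.\<close>
  let ?e = "support_fun {} h"
  have "open ?U"
    by (intro open_Collect_less continuous_intros continuous_on_paraboloid)
  then have hit: "{K \<in> space compacts_borel. K \<inter> ?U \<noteq> {}} \<in> sets compacts_borel"
    by (rule hitting_set_measurable)
  have "{K \<in> space compacts_borel. c < support_fun (paraboloid ` K) h} =
      {K \<in> space compacts_borel. K \<inter> ?U \<noteq> {}} \<union>
      (if c < ?e then space compacts_borel - {K \<in> space compacts_borel. K \<noteq> {}} else {})"
    (is "?A = ?B")
  proof (rule set_eqI)
    fix K show "K \<in> ?A \<longleftrightarrow> K \<in> ?B"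
    proof (cases "K = {}")
      case False
      then have "c < support_fun (paraboloid ` K) h \<longleftrightarrow> (\<exists>z\<in>K. c < h \<bullet> paraboloid z)" if "compact K"
        using that by (simp add: support_fun_less_iff compact_paraboloid_image)
      with False show ?thesis by (auto simp: space_compacts_borel)
    qed auto
  qed
  also have "\<dots> \<in> sets compacts_borel" using hit nonempty_measurable by auto
  finally show "{K \<in> space compacts_borel. c < support_fun (paraboloid ` K) h} \<in> sets compacts_borel" .
qed

text \<open>\<open>T\<close> pairs directions with target values, and \<open>e\<close> is half the
  side of the cube around the targets. Since the empty set is excluded, the test with
  \<open>T = {}\<close> and \<open>e = 1\<close> detects nonemptiness.\<close>

definition support_test :: "((real^4) \<times> real) set \<Rightarrow> real \<Rightarrow> complex set set" where
  "support_test T e = {K \<in> space compacts_borel. K \<noteq> {} \<and>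
     (\<exists>S :: real^4^4. \<forall>(a, q)\<in>T. \<bar>support_fun (paraboloid ` K) (a v* S) - q\<bar> < e)}"

text \<open>For fixed \<open>K\<close> the admissible matrices form an open set, so the existential
  quantifier may be restricted to a countable dense set.\<close>

lemma support_test_measurable:
  assumes "finite T"
  shows "support_test T e \<in> sets compacts_borel"
proof -
  obtain Z :: "(real^4^4) set" where Z: "countable Z" "\<And>X. open X \<Longrightarrow> X \<noteq> {} \<Longrightarrow> \<exists>d\<in>Z. d \<in> X"
    using countable_dense_setE by blast
  let ?P = "\<lambda>K S. \<forall>(a, q)\<in>T. \<bar>support_fun (paraboloid ` K) (a v* S) - q\<bar> < e"
  have "(\<exists>S. ?P K S) \<longleftrightarrow> (\<exists>S\<in>Z. ?P K S)" if "compact K" "K \<noteq> {}" for K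
  proof -
    have "continuous_on UNIV (\<lambda>S :: real^4^4. support_fun (paraboloid ` K) (a v* S))" for a
      using that by (intro continuous_on_compose2[OF continuous_on_support_fun[of _ UNIV] continuous_on_vector_matrix_mult])
        (auto simp: compact_paraboloid_image)
    then have "open {S :: real^4^4. \<bar>support_fun (paraboloid ` K) (a v* S) - q\<bar> < e}" for a q
      by (intro open_Collect_less continuous_intros)
    then have "open (\<Inter>p\<in>T. {S :: real^4^4. \<bar>support_fun (paraboloid ` K) (fst p v* S) - snd p\<bar> < e})"
      using assms by (intro open_INT) auto
    also have "(\<Inter>p\<in>T. {S :: real^4^4. \<bar>support_fun (paraboloid ` K) (fst p v* S) - snd p\<bar> < e}) = {S. ?P K S}"
      by (auto simp: case_prod_beta)
    finally show ?thesis using Z(2)[of "{S. ?P K S}"] by blast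
  qed
  then have "support_test T e = {K \<in> space compacts_borel. K \<noteq> {} \<and> (\<exists>S\<in>Z. ?P K S)}"
    unfolding support_test_def space_compacts_borel by (intro Collect_cong conj_cong refl) auto
  also have "\<dots> = {K \<in> space compacts_borel. K \<noteq> {}} \<inter>
      (\<Union>S\<in>Z. {K \<in> space compacts_borel. ?P K S})"
    by blast
  also have "\<dots> \<in> sets compacts_borel"
  proof (intro sets.Int nonempty_measurable sets.countable_UN'' Z(1))
    fix S :: "real^4^4"
    have "{K \<in> space compacts_borel. \<bar>support_fun (paraboloid ` K) (a v* S) - q\<bar> < e} \<in> sets compacts_borel" for a q
      using support_fun_measurable[of "a v* S"] by measurable
    then show "{K \<in> space compacts_borel. ?P K S} \<in> sets compacts_borel"
      unfolding case_prod_beta by (intro sets.sets_Collect_finite_All' sets.sets_Collect_finite_All assms)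
  qed
  finally show ?thesis .
qed

section \<open>Invariance and completeness of the tests\<close>

lemma support_test_invariant:
  assumes "degree1_homeomorphic D L" "compact D" "compact L" "D \<in> support_test T e"
  shows "L \<in> support_test T e"
proof -
  obtain B :: "real^4^4" where B: "\<And>h. support_fun (paraboloid ` D) h = support_fun (paraboloid ` L) (h v* B)"
    using degree1_homeomorphic_support_fun[OF degree1_homeomorphic_sym[OF assms(1)]] by blast
  obtain S :: "real^4^4" where S: "\<forall>(a, q)\<in>T. \<bar>support_fun (paraboloid ` D) (a v* S) - q\<bar> < e"
    using assms(4) unfolding support_test_def by blast
  \<comment> \<open>The lift of \<open>D\<close> is the image of that of \<open>L\<close> under
    \<open>B\<close>, so a witness \<open>S\<close> for \<open>D\<close> becomes
    \<open>S ** B\<close> for \<open>L\<close>.\<close>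
  have "\<forall>(a, q)\<in>T. \<bar>support_fun (paraboloid ` L) (a v* (S ** B)) - q\<bar> < e"
    using S by (simp add: B vector_matrix_mul_assoc)
  moreover have "L \<noteq> {}"
    using assms(1,4) by (auto simp: degree1_homeomorphic_def degree1_homeomorphism_def homeomorphism_def support_test_def)
  ultimately show ?thesis using assms(3) unfolding support_test_def space_compacts_borel by blast
qed

text \<open>With rational targets close to its own support values, \<open>D\<close> passes the test
  by the identity matrix. Then \<open>L\<close> passes too, and its witness is the required
  matrix.\<close>

lemma support_tests_approx:
  fixes D L :: "complex set"
  assumes D: "compact D" "D \<noteq> {}"
    and tests: "\<And>T n. finite T \<Longrightarrow> T \<subseteq> X \<times> \<rat> \<Longrightarrow>
      D \<in> support_test T (1 / Suc n) \<Longrightarrow> L \<in> support_test T (1 / Suc n)"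
    and T: "finite T" "T \<subseteq> X" and e: "0 < e"
  shows "\<exists>S :: real^4^4. \<forall>a\<in>T. \<bar>support_fun (paraboloid ` L) (a v* S) - support_fun (paraboloid ` D) a\<bar> < e"
proof -
  \<comment> \<open>Two errors below \<open>1 / Suc n\<close> add up: rounding to the rationals and
    the tolerance of the test.\<close>
  obtain n where n: "1 / Suc n < e / 2" using e nat_approx_posE[of "e / 2"] by (metis half_gt_zero)
  have "\<exists>q\<in>\<rat>. \<bar>support_fun (paraboloid ` D) a - q\<bar> < 1 / Suc n" for a
    using Rats_dense_in_real[of "support_fun (paraboloid ` D) a - 1 / Suc n" "support_fun (paraboloid ` D) a"]
    by (force simp: abs_less_iff)
  then obtain q where q: "\<And>a. q a \<in> \<rat>" "\<And>a. \<bar>support_fun (paraboloid ` D) a - q a\<bar> < 1 / Suc n"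
    by metis
  let ?T = "(\<lambda>a. (a, q a)) ` T"
  have "D \<in> support_test ?T (1 / Suc n)"
    using D q(2) unfolding support_test_def space_compacts_borel by (auto intro!: exI[of _ "mat 1"])
  then have "L \<in> support_test ?T (1 / Suc n)" using T q(1) by (intro tests) auto
  then obtain S :: "real^4^4" where S: "\<forall>a\<in>T. \<bar>support_fun (paraboloid ` L) (a v* S) - q a\<bar> < 1 / Suc n"
    unfolding support_test_def by auto
  have "\<bar>support_fun (paraboloid ` L) (a v* S) - support_fun (paraboloid ` D) a\<bar> < e" if "a \<in> T" for a
    using S that q(2)[of a] n by fastforce
  then show ?thesis by blast
qed

lemma degree1_homeomorphic_if_support_tests:
  assumes X: "countable X" "closure X = UNIV" "\<And>i. axis i 1 \<in> X" "\<And>i. - axis i 1 \<in> X"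
    and D: "compact D" and L: "compact L"
    and tests: "\<And>T n. finite T \<Longrightarrow> T \<subseteq> X \<times> \<rat> \<Longrightarrow>
      D \<in> support_test T (1 / Suc n) \<longleftrightarrow> L \<in> support_test T (1 / Suc n)"
  shows "degree1_homeomorphic D L"
proof (cases "D = {}")
  case True
  \<comment> \<open>The test without directions only asks for nonemptiness, so \<open>D\<close> and
    \<open>L\<close> are empty together.\<close>
  have "D \<in> support_test {} 1 \<longleftrightarrow> L \<in> support_test {} 1" using tests[of "{}" 0] by simp
  then have "L = {}" using True L by (auto simp: support_test_def space_compacts_borel)
  then show ?thesis using True degree1_homeomorphic_refl by simp
next
  case False
  have "D \<in> support_test {} 1 \<longleftrightarrow> L \<in> support_test {} 1" using tests[of "{}" 0] by simp
  then have L': "L \<noteq> {}" using False D by (auto simp: support_test_def space_compacts_borel)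
  note c = compact_paraboloid_image[OF D] compact_paraboloid_image[OF L]
  have ne: "paraboloid ` D \<noteq> {}" "paraboloid ` L \<noteq> {}" using False L' by auto
  have "\<exists>S :: real^4^4. \<forall>a\<in>T. \<bar>support_fun (paraboloid ` L) (a v* S) - support_fun (paraboloid ` D) a\<bar> < e"
    if "finite T" "T \<subseteq> X" "0 < e" for T e
    by (rule support_tests_approx[OF D False _ that]) (rule tests[THEN iffD1])
  from exists_matrix_support_fun[OF c(1) ne(1) c(2) ne(2) X this]
  obtain S :: "real^4^4" where S: "\<And>a. support_fun (paraboloid ` L) (a v* S) = support_fun (paraboloid ` D) a"
    by metis
  have "\<exists>S :: real^4^4. \<forall>a\<in>T. \<bar>support_fun (paraboloid ` D) (a v* S) - support_fun (paraboloid ` L) a\<bar> < e"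
    if "finite T" "T \<subseteq> X" "0 < e" for T e
    by (rule support_tests_approx[OF L L' _ that]) (rule tests[THEN iffD2])
  from exists_matrix_support_fun[OF c(2) ne(2) c(1) ne(1) X this]
  obtain T :: "real^4^4" where T: "\<And>a. support_fun (paraboloid ` D) (a v* T) = support_fun (paraboloid ` L) a"
    by metis
  note S_image = matrix_image_eq_if_support_fun[OF c(1) ne(1) c(2) ne(2)
      paraboloid_convex_independent paraboloid_convex_independent S T]
  have "degree1_homeomorphic L D"
    by (rule degree1_homeomorphicI) (rule S_image; assumption)+
  then show ?thesis by (rule degree1_homeomorphic_sym)
qed

theorem theorem4p12:
  shows "smooth_equivalence (compacts_borel :: complex set measure) degree1_rel"
proof -
  obtain X0 :: "(real^4) set" where X0: "countable X0" "\<And>U. open U \<Longrightarrow> U \<noteq> {} \<Longrightarrow> \<exists>d\<in>X0. d \<in> U"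
    using countable_dense_setE by blast
  \<comment> \<open>The dense set is enlarged by the axis vectors and their negatives, as the
    compactness argument requires.\<close>
  define X where "X = X0 \<union> range (\<lambda>i. axis i 1) \<union> range (\<lambda>i. - axis i 1)"
  have X: "countable X" "\<And>i. axis i 1 \<in> X" "\<And>i. - axis i 1 \<in> X"
    using X0(1) by (auto simp: X_def)
  have "closure X0 = UNIV"
    using X0(2) by (rule closure_eq_UNIV_if_dense)
  then have "closure X = UNIV" unfolding X_def by (auto simp: closure_Un)
  define \<A> where "\<A> = (\<lambda>(T, n). support_test T (1 / Suc n)) ` ({T. finite T \<and> T \<subseteq> X \<times> \<rat>} \<times> UNIV)"
  show ?thesis
  proof (rule smooth_equivalenceI)
    show "equiv (space compacts_borel) degree1_rel"
      unfolding space_compacts_borel by (rule equiv_degree1_rel)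
    \<comment> \<open>The countable set \<open>X \<times> \<rat>\<close> has only countably many
      finite subsets.\<close>
    show "countable \<A>"
      unfolding \<A>_def using X(1) countable_rat
      by (intro countable_image countable_SIGMA countable_Collect_finite_subset) auto
    show "\<A> \<subseteq> sets compacts_borel" by (auto simp: \<A>_def support_test_measurable)
    fix D L :: "complex set" assume "D \<in> space compacts_borel" "L \<in> space compacts_borel"
    then have c: "compact D" "compact L" by (auto simp: space_compacts_borel)
    have "degree1_homeomorphic D L \<longleftrightarrow>
      (\<forall>T n. finite T \<longrightarrow> T \<subseteq> X \<times> \<rat> \<longrightarrow> (D \<in> support_test T (1 / Suc n) \<longleftrightarrow> L \<in> support_test T (1 / Suc n)))"
      using support_test_invariant[of D L] support_test_invariant[of L D] c degree1_homeomorphic_sym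
        degree1_homeomorphic_if_support_tests[OF X(1) \<open>closure X = UNIV\<close> X(2,3) c] by meson
    then show "(D, L) \<in> degree1_rel \<longleftrightarrow> (\<forall>A\<in>\<A>. D \<in> A \<longleftrightarrow> L \<in> A)"
      using c by (auto simp: degree1_rel_def \<A>_def)
  qed
qed

end
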